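(* Let $A,B\in M_2$. Suppose $\operatorname{tr} B=0$. Then $W_A(B)=W_{A\oplus 0}(B\oplus 0)$ if and only if $(\operatorname{tr} A)W(B)\subseteq W_A(B)$.
   Context: $M_n$ is the space of $n\times n$ complex matrices and $U_n$ the group of $n\times n$ unitary matrices. For $B\in M_n$, the classical numerical range is $W(B)=\{x^*Bx : x\in\mathbb{C}^n,\ x^*x=1\}$. For $A,B\in M_n$, the $A$-numerical range of $B$ is $W_A(B)=\{\operatorname{tr}(A\,VBV^* ) : V\in U_n\}$. For $X\in M_2$, $X\oplus 0\in M_3$ denotes the direct sum of $X$ with the $1\times 1$ zero matrix. For $c\in\mathbb{C}$ and $S\subseteq\mathbb{C}$, $cS=\{cs: s\in S\}$. *)

theory Defs
  imports "HOL-Analysis.Analysis"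
begin

text \<open>
  The type \<open>complex ^ 'n ^ 'n\<close> is the space of square complex matrices of size \<open>CARD('n)\<close>;
  \<open>A $ i $ j\<close> is the entry in row \<open>i\<close> and column \<open>j\<close>.
\<close>

definition conj_transpose :: "complex ^ 'n ^ 'm \<Rightarrow> complex ^ 'm ^ 'n" where
  "conj_transpose A = (\<chi> i j. cnj (A $ j $ i))"

definition unitary :: "complex ^ 'n ^ 'n \<Rightarrow> bool" where
  "unitary V \<longleftrightarrow> V ** conj_transpose V = mat 1 \<and> conj_transpose V ** V = mat 1"

text \<open>
  The inner product \<open>\<bullet>\<close> on \<open>complex ^ 'n\<close> is the real one, so the product \<open>x\<^sup>* y\<close> is
  introduced separately (conjugate-linear in the first argument).
\<close>

definition cinner_vec :: "complex ^ 'n \<Rightarrow> complex ^ 'n \<Rightarrow> complex" where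
  "cinner_vec x y = (\<Sum>i\<in>UNIV. cnj (x $ i) * y $ i)"

definition numerical_range :: "complex ^ 'n ^ 'n \<Rightarrow> complex set" where
  "numerical_range B = {cinner_vec x (B *v x) | x. cinner_vec x x = 1}"

definition A_numerical_range :: "complex ^ 'n ^ 'n \<Rightarrow> complex ^ 'n ^ 'n \<Rightarrow> complex set" where
  "A_numerical_range A B = {trace (A ** (V ** B ** conj_transpose V)) | V. unitary V}"

definition dsum_zero :: "complex ^ 2 ^ 2 \<Rightarrow> complex ^ 3 ^ 3" where
  "dsum_zero X =
     vector [vector [X $ 1 $ 1, X $ 1 $ 2, 0],
             vector [X $ 2 $ 1, X $ 2 $ 2, 0],
             vector [0,         0,         0]]"

end

theory Submission
  imports Defs
begin

text \<open>
  Write \<open>E\<close> for the \<open>A\<close>-numerical range of \<open>B\<close> and \<open>F\<close> for the one of the enlarged matrices.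
  Always \<open>E \<subseteq> F\<close>, and \<open>F\<close> consists of the numbers \<open>tr (A K B K\<^sup>*)\<close> where \<open>K\<close> is the upper left
  \<open>2 \<times> 2\<close> block of a \<open>3 \<times> 3\<close> unitary matrix. After replacing \<open>A\<close> and \<open>B\<close> by unitarily similar
  matrices, \<open>K\<close> is diagonal with entries of modulus \<open>1\<close> and \<open>t \<in> [0, 1]\<close>, or is itself unitary
  (\<open>corner_unitary_or_diag\<close>).

  Everything rests on one identity (\<open>trace_diag_compression\<close>). If \<open>tr B = 0\<close> and
  \<open>D = diag (1, t)\<close>, then
    \<open>tr (A D B D\<^sup>*) = ((1 - t\<^sup>2) / 2) P + ((1 + t)\<^sup>2 / 4) Q + ((1 - t)\<^sup>2 / 4) R\<close>,
  where \<open>P = (tr A) B\<^sub>1\<^sub>1\<close> lies in \<open>(tr A) W(B)\<close>, and \<open>Q\<close> and \<open>R\<close> are the values for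
  \<open>D = diag (1, 1)\<close> and \<open>D = diag (1, -1)\<close>, hence lie in \<open>E\<close>. For \<open>t \<in> [0, 1]\<close> the three
  coefficients are nonnegative with sum \<open>1\<close>. The lemma has the same identity for diagonal entries
  with phases.

  Suppose \<open>(tr A) W(B) \<subseteq> E\<close>. Then the identity writes every point of \<open>F\<close> as a convex
  combination of points of \<open>E\<close>, and \<open>F \<subseteq> E\<close> follows because \<open>E\<close> is convex.

  Suppose \<open>E = F\<close> and that some \<open>P \<in> (tr A) W(B)\<close> is outside \<open>E\<close>. As \<open>E\<close> is compact and convex, a
  real linear functional separates \<open>P\<close> strictly from \<open>E\<close>. The unitary frames of \<open>A\<close> and \<open>B\<close> can be
  chosen independently, so \<open>P\<close> can be combined with a point \<open>Q\<close> at which the functional is extremal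
  on \<open>E\<close>. The right-hand side of the identity stays in \<open>F = E\<close> for all \<open>t\<close>, but equals
  \<open>Q + (1 - t) (P - Q) + O((1 - t)\<^sup>2)\<close>, which is outside \<open>E\<close> for \<open>t < 1\<close> close to \<open>1\<close>.

  Convexity of \<open>E\<close> comes from Brickman's theorem (\<open>convex_quadratic_image_sphere\<close>): a pair of real
  quadratic forms maps the unit sphere of a space of dimension at least \<open>3\<close> onto a convex set. A
  \<open>2 \<times> 2\<close> unitary matrix is a scalar times an element of \<open>SU(2)\<close>, which is a point of the unit sphere
  of \<open>\<complex>\<^sup>2\<close>, and \<open>tr (A V B V\<^sup>*)\<close> is quadratic in that point.
\<close>

section \<open>Brickman's theorem on the image of the sphere under two quadratic forms\<close>

text \<open>
  Two isotropic vectors of a quadratic form can be joined, up to a sign, by an isotropic path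
  avoiding \<open>0\<close>. In the span of \<open>x\<close> and \<open>y\<close> the form is a multiple of \<open>\<alpha> \<beta>\<close> in the
  coordinates \<open>\<alpha> x + \<beta> y\<close>, and its zeros may be just the two lines through \<open>x\<close> and \<open>y\<close>; the
  third dimension makes room for a detour.
\<close>
lemma isotropic_path:
  fixes S :: "'a::euclidean_space \<Rightarrow> 'a \<Rightarrow> real"
  assumes S: "bilinear S" and sym: "\<And>v w. S v w = S w v"
    and iso: "S x x = 0" "S y y = 0"
    and ind: "x \<noteq> 0" "y \<notin> span {x}"
    and dim: "DIM('a) \<ge> 3"
  shows "\<exists>\<gamma>::real \<Rightarrow> 'a. continuous_on {0..1} \<gamma> \<and> \<gamma> 0 = x \<and> (\<gamma> 1 = y \<or> \<gamma> 1 = - y) \<and>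
    (\<forall>s\<in>{0..1}. \<gamma> s \<noteq> 0 \<and> S (\<gamma> s) (\<gamma> s) = 0)"
proof -
  note expand = bilinear_ladd[OF S] bilinear_radd[OF S] bilinear_lmul[OF S] bilinear_rmul[OF S]
    bilinear_lsub[OF S] bilinear_rsub[OF S] bilinear_lneg[OF S] bilinear_rneg[OF S]
  have nz2: "\<alpha> = 0 \<and> \<beta> = 0" if "\<alpha> *\<^sub>R x + \<beta> *\<^sub>R y = 0" for \<alpha> \<beta>
  proof (cases "\<beta> = 0")
    case False
    have "y = (- \<alpha> / \<beta>) *\<^sub>R x"
    proof -
      have "\<beta> *\<^sub>R y = (- \<alpha>) *\<^sub>R x"
        using that by (simp add: add_eq_0_iff)
      then have "inverse \<beta> *\<^sub>R \<beta> *\<^sub>R y = inverse \<beta> *\<^sub>R (- \<alpha>) *\<^sub>R x" by simp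
      then show ?thesis using False by (simp add: divide_inverse mult.commute)
    qed
    then show ?thesis using ind(2) by (metis span_base span_scale insertI1)
  qed (use that ind in auto)
  have nz3: "\<alpha> = 0 \<and> \<beta> = 0 \<and> \<kappa> = 0"
    if "z \<notin> span {x, y}" "\<alpha> *\<^sub>R x + \<beta> *\<^sub>R y + \<kappa> *\<^sub>R z = 0" for \<alpha> \<beta> \<kappa> z
  proof (cases "\<kappa> = 0")
    case False
    have "z = (- \<alpha> / \<kappa>) *\<^sub>R x + (- \<beta> / \<kappa>) *\<^sub>R y"
    proof -
      have "\<kappa> *\<^sub>R z = (- \<alpha>) *\<^sub>R x + (- \<beta>) *\<^sub>R y"
        using that(2) by (simp add: add_eq_0_iff algebra_simps)
      then have "inverse \<kappa> *\<^sub>R \<kappa> *\<^sub>R z = inverse \<kappa> *\<^sub>R ((- \<alpha>) *\<^sub>R x + (- \<beta>) *\<^sub>R y)" by simp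
      then show ?thesis using False by (simp add: algebra_simps divide_inverse)
    qed
    then show ?thesis using that(1) by (metis span_add span_base span_scale insertI1 insertI2)
  qed (use that(2) nz2 in auto)
  define g where "g = S x y"
  show ?thesis
  proof (cases "g = 0")
    case True
    define \<gamma> where "\<gamma> s = (1 - s) *\<^sub>R x + s *\<^sub>R y" for s
    have "continuous_on {0..1} \<gamma>" unfolding \<gamma>_def by (intro continuous_intros)
    moreover have "\<gamma> s \<noteq> 0" for s using nz2[of "1 - s" s] by (auto simp: \<gamma>_def)
    moreover have "S (\<gamma> s) (\<gamma> s) = 0" for s
      using True iso sym[of y x] by (simp add: \<gamma>_def expand g_def)
    ultimately show ?thesis by (intro exI[of _ \<gamma>]) (auto simp: \<gamma>_def)
  next
    case False
    have "span {x, y} \<noteq> UNIV"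
    proof
      assume "span {x, y} = UNIV"
      then have "DIM('a) = dim {x, y}" by (metis dim_UNIV dim_span)
      also have "\<dots> \<le> card {x, y}" by (rule dim_le_card') simp
      also have "\<dots> \<le> 2" by (simp add: card_insert_if)
      finally show False using dim by simp
    qed
    then obtain z0 where z0: "z0 \<notin> span {x, y}" by auto
    \<comment> \<open>The part of \<open>z0\<close> orthogonal to \<open>x\<close> and \<open>y\<close> for \<open>S\<close>: at \<open>\<alpha> x + \<beta> y + \<zeta> z\<close> the form
      is \<open>2 g \<alpha> \<beta> + l \<zeta>\<^sup>2\<close>, with \<open>l\<close> defined below.\<close>
    define z where "z = z0 - (S z0 y / g) *\<^sub>R x - (S z0 x / g) *\<^sub>R y"
    have z: "z \<notin> span {x, y}"
    proof
      assume "z \<in> span {x, y}"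
      then have "z + (S z0 y / g) *\<^sub>R x + (S z0 x / g) *\<^sub>R y \<in> span {x, y}"
        by (blast intro: span_add span_scale span_base)
      then show False using z0 by (simp add: z_def)
    qed
    have Sz: "S z x = 0" "S z y = 0" "S x z = 0" "S y z = 0"
      using False iso sym[of y x] sym[of x z] sym[of y z] by (simp_all add: z_def expand g_def)
    define l where "l = S z z"
    show ?thesis
    proof (cases "l = 0")
      case True
      \<comment> \<open>The form is now \<open>2 g \<alpha> \<beta>\<close>: go from \<open>x\<close> to a multiple of \<open>z\<close> and then to \<open>y\<close>, with one of
        the first two coordinates always \<open>0\<close>.\<close>
      define \<gamma> where "\<gamma> s = max 0 (1 - 2 * s) *\<^sub>R x + max 0 (2 * s - 1) *\<^sub>R y + (s * (1 - s)) *\<^sub>R z"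
        for s :: real
      have "continuous_on {0..1} \<gamma>" unfolding \<gamma>_def by (intro continuous_intros)
      moreover have "\<gamma> s \<noteq> 0" for s
        using nz3[OF z, of "max 0 (1 - 2 * s)" "max 0 (2 * s - 1)" "s * (1 - s)"]
        by (auto simp: \<gamma>_def)
      moreover have "S (\<gamma> s) (\<gamma> s) = 0" for s
        using True iso Sz by (auto simp: \<gamma>_def expand l_def max_def)
      ultimately show ?thesis by (intro exI[of _ \<gamma>]) (auto simp: \<gamma>_def)
    next
      case l: False
      \<comment> \<open>The coordinates are \<open>1 - s\<close>, \<open>\<epsilon> s\<close> and \<open>\<kappa> sqrt (s (1 - s))\<close>; the sign \<open>\<epsilon>\<close> of \<open>y\<close> and the
        size \<open>\<kappa>\<close> are chosen so that the two terms of the form cancel.\<close>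
      define \<rho> where "\<rho> = g / l"
      define \<epsilon> :: real where "\<epsilon> = (if \<rho> > 0 then -1 else 1)"
      define \<kappa> where "\<kappa> = sqrt (2 * \<bar>\<rho>\<bar>)"
      have "\<kappa>\<^sup>2 = 2 * \<bar>\<rho>\<bar>" by (simp add: \<kappa>_def)
      also have "\<bar>\<rho>\<bar> = - \<epsilon> * \<rho>" by (simp add: \<epsilon>_def)
      finally have \<kappa>: "\<kappa>\<^sup>2 * l = - (2 * \<epsilon> * g)" using l by (simp add: \<rho>_def)
      define \<gamma> where "\<gamma> s = (1 - s) *\<^sub>R x + (s * \<epsilon>) *\<^sub>R y + (\<kappa> * sqrt (s * (1 - s))) *\<^sub>R z" for s
      have "continuous_on {0..1} \<gamma>" unfolding \<gamma>_def by (intro continuous_intros)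
      moreover have "\<gamma> s \<noteq> 0" for s
        using nz3[OF z, of "1 - s" "s * \<epsilon>" "\<kappa> * sqrt (s * (1 - s))"]
        by (auto simp: \<gamma>_def \<epsilon>_def split: if_splits)
      moreover have "S (\<gamma> s) (\<gamma> s) = 0" if "s \<in> {0..1}" for s
      proof -
        have "S (\<gamma> s) (\<gamma> s) = 2 * (s * (1 - s)) * \<epsilon> * g + (\<kappa> * sqrt (s * (1 - s)))\<^sup>2 * l"
          using iso Sz sym[of y x] unfolding \<gamma>_def g_def l_def
          by (simp add: expand) (simp add: algebra_simps power2_eq_square)
        also have "(\<kappa> * sqrt (s * (1 - s)))\<^sup>2 * l = (s * (1 - s)) * (\<kappa>\<^sup>2 * l)"
          using that by (simp add: power_mult_distrib)
        finally show ?thesis unfolding \<kappa> by (simp add: algebra_simps)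
      qed
      ultimately show ?thesis by (intro exI[of _ \<gamma>]) (auto simp: \<gamma>_def \<epsilon>_def)
    qed
  qed
qed

text \<open>
  Brickman's theorem. The bilinear map need not be symmetric, since only its diagonal values matter;
  the two quadratic forms are the real and imaginary parts.
\<close>
theorem convex_quadratic_image_sphere:
  fixes G :: "'a::euclidean_space \<Rightarrow> 'a \<Rightarrow> complex"
  assumes G: "bilinear G" and dim: "DIM('a) \<ge> 3"
  shows "convex ((\<lambda>v. G v v) ` sphere 0 1)"
  unfolding convex_alt
proof clarify
  fix x y :: 'a and u :: real
  assume xy: "x \<in> sphere 0 1" "y \<in> sphere 0 1" and u: "0 \<le> u" "u \<le> 1"
  define p q where "p = G x x" and "q = G y y"
  note expand = bilinear_ladd[OF G] bilinear_radd[OF G] bilinear_lmul[OF G] bilinear_rmul[OF G]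
    bilinear_lneg[OF G] bilinear_rneg[OF G]
  have nx: "norm x = 1" "norm y = 1" using xy by auto
  show "(1 - u) *\<^sub>R G x x + u *\<^sub>R G y y \<in> (\<lambda>v. G v v) ` sphere 0 1"
  proof (cases "p = q")
    case True
    then have "(1 - u) *\<^sub>R G x x + u *\<^sub>R G y y = G x x"
      by (simp add: p_def q_def flip: scaleR_add_left)
    then show ?thesis using xy by auto
  next
    case False
    \<comment> \<open>On the unit sphere the diagonal of \<open>H\<close> is an affine image of that of \<open>G\<close>, taking the two
      given values to \<open>0\<close> and \<open>1\<close>. A point of the segment is then a real value of \<open>H\<close>, so the
      argument runs along the cone where \<open>Im H\<close> vanishes.\<close>
    define H where "H v w = (G v w - of_real (v \<bullet> w) * p) / (q - p)" for v w
    define S where "S v w = Im (H v w + H w v)" for v w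
    have H: "H x x = 0" "H y y = 1"
      using nx False by (simp_all add: H_def p_def q_def dot_square_norm)
    have ind: "y \<notin> span {x}"
    proof
      assume "y \<in> span {x}"
      then obtain c where c: "y = c *\<^sub>R x" by (auto simp: span_singleton)
      then have "\<bar>c\<bar> = 1" using nx by simp
      then have "c * c = 1" by (metis abs_mult_self_eq mult_1)
      then have "q = p" by (simp add: p_def q_def c expand)
      then show False using False by simp
    qed
    have bil: "bilinear S"
    proof -
      define k where "k = inverse (q - p)"
      have S: "S v w = Im (k * (G v w + G w v)) - 2 * (v \<bullet> w) * Im (k * p)" for v w
        by (simp add: S_def H_def k_def divide_inverse algebra_simps inner_commute[of w v])
      show ?thesis
        by (auto simp: bilinear_def S expand linear_iff inner_simps algebra_simps)
    qed
    have x0: "x \<noteq> 0" using nx by auto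
    have sym: "S v w = S w v" for v w by (simp add: S_def add.commute)
    have iso: "S x x = 0" "S y y = 0" using H by (simp_all add: S_def)
    from isotropic_path[OF bil sym iso x0 ind dim] obtain \<gamma> :: "real \<Rightarrow> 'a" where
      path: "continuous_on {0..1} \<gamma> \<and> \<gamma> 0 = x \<and> (\<gamma> 1 = y \<or> \<gamma> 1 = - y) \<and>
        (\<forall>s\<in>{0..1}. \<gamma> s \<noteq> 0 \<and> S (\<gamma> s) (\<gamma> s) = 0)" ..
    have \<gamma>: "continuous_on {0..1} \<gamma>" "\<gamma> 0 = x" "\<gamma> 1 = y \<or> \<gamma> 1 = - y"
      using path by simp_all
    have \<gamma>0: "\<gamma> s \<noteq> 0" "S (\<gamma> s) (\<gamma> s) = 0" if "s \<in> {0..1}" for s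
      using path that by simp_all
    define h where "h s = Re (H (\<gamma> s) (\<gamma> s)) / (norm (\<gamma> s))\<^sup>2" for s
    have "bounded_bilinear G" using G by (simp add: bilinear_conv_bounded_bilinear)
    from bounded_bilinear.continuous_on[OF this \<gamma>(1) \<gamma>(1)]
    have "continuous_on {0..1} (\<lambda>s. G (\<gamma> s) (\<gamma> s))" .
    then have "continuous_on {0..1} h"
      unfolding h_def H_def using \<gamma>(1) \<gamma>0(1) False by (intro continuous_intros) auto
    moreover have "h 0 = 0" "h 1 = 1"
      using \<gamma> H nx by (auto simp: h_def H_def expand)
    ultimately obtain s where s: "s \<in> {0..1}" "h s = u"
      using IVT'[of h 0 u 1] u by auto
    define v where "v = \<gamma> s /\<^sub>R norm (\<gamma> s)"
    have nv: "norm v = 1" using \<gamma>0(1)[OF s(1)] by (simp add: v_def)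
    have "H v v = of_real u"
    proof -
      have "H (c *\<^sub>R w) (c *\<^sub>R w) = of_real (c\<^sup>2) * H w w" for c w
        by (simp add: H_def expand scaleR_conv_of_real power2_eq_square divide_inverse algebra_simps)
      then have "H v v = H (\<gamma> s) (\<gamma> s) / of_real ((norm (\<gamma> s))\<^sup>2)"
        by (simp add: v_def divide_inverse mult.commute flip: power_inverse)
      moreover have "Im (H (\<gamma> s) (\<gamma> s)) = 0" using \<gamma>0(2)[OF s(1)] by (simp add: S_def)
      ultimately show ?thesis using s(2)
        by (simp add: complex_eq_iff h_def Re_divide_of_real Im_divide_of_real del: of_real_power)
    qed
    then have "G v v = p + of_real u * (q - p)"
      using False nv by (simp add: H_def field_simps dot_square_norm)
    then have "(1 - u) *\<^sub>R G x x + u *\<^sub>R G y y = G v v"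
      by (simp add: p_def q_def scaleR_conv_of_real algebra_simps)
    then show ?thesis using nv by auto
  qed
qed

section \<open>Unitary equivalence and the \<open>A\<close>-numerical range\<close>

lemma conj_transpose_mult:
  "conj_transpose (A ** B) = conj_transpose B ** conj_transpose A"
  by (simp add: conj_transpose_def matrix_matrix_mult_def vec_eq_iff mult.commute)

lemma conj_transpose_conj_transpose [simp]: "conj_transpose (conj_transpose A) = A"
  by (simp add: conj_transpose_def vec_eq_iff)

lemma unitary_conj_transpose: "unitary V \<Longrightarrow> unitary (conj_transpose V)"
  by (simp add: unitary_def)

lemma unitary_mult:
  assumes "unitary U" "unitary V"
  shows "unitary (U ** V)"
proof -
  have "U ** V ** (conj_transpose V ** conj_transpose U)
      = U ** (V ** conj_transpose V) ** conj_transpose U"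
    by (simp add: matrix_mul_assoc)
  moreover have "conj_transpose V ** conj_transpose U ** (U ** V)
      = conj_transpose V ** (conj_transpose U ** U) ** V"
    by (simp add: matrix_mul_assoc)
  ultimately show ?thesis using assms by (simp add: unitary_def conj_transpose_mult)
qed

lemma trace_unitary_conjugate:
  fixes A B V :: "complex ^ 'n ^ 'n"
  assumes "unitary U" "unitary W"
  shows "trace (U ** A ** conj_transpose U **
      (U ** V ** W ** (conj_transpose W ** B ** W) ** conj_transpose (U ** V ** W)))
    = trace (A ** (V ** B ** conj_transpose V))"
proof -
  have U: "conj_transpose U ** U = mat 1" and W: "W ** conj_transpose W = mat 1"
    using assms by (auto simp: unitary_def)
  have "U ** A ** conj_transpose U **
      (U ** V ** W ** (conj_transpose W ** B ** W) ** conj_transpose (U ** V ** W))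
    = U ** A ** (conj_transpose U ** U) ** V ** (W ** conj_transpose W) ** B
      ** (W ** conj_transpose W) ** conj_transpose V ** conj_transpose U"
    by (simp add: conj_transpose_mult matrix_mul_assoc)
  also have "\<dots> = U ** (A ** V ** B ** conj_transpose V ** conj_transpose U)"
    by (simp add: U W matrix_mul_assoc)
  also have "trace \<dots> = trace (A ** V ** B ** conj_transpose V ** conj_transpose U ** U)"
    by (rule trace_mul_sym)
  also have "A ** V ** B ** conj_transpose V ** conj_transpose U ** U
      = A ** (V ** B ** conj_transpose V)"
    by (simp add: matrix_mul_assoc[symmetric] U)
  finally show ?thesis .
qed

text \<open>
  The frames \<open>U\<close> of \<open>A\<close> and \<open>W\<close> of \<open>B\<close> are independent of each other.
\<close>
lemma A_numerical_range_unitary_conjugate: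
  assumes "unitary U" "unitary W"
  shows "A_numerical_range (U ** A ** conj_transpose U) (conj_transpose W ** B ** W)
    = A_numerical_range A B"
proof (intro equalityI subsetI)
  fix z assume "z \<in> A_numerical_range A B"
  then obtain V where "unitary V" "z = trace (A ** (V ** B ** conj_transpose V))"
    by (auto simp: A_numerical_range_def)
  then show "z \<in> A_numerical_range (U ** A ** conj_transpose U) (conj_transpose W ** B ** W)"
    using trace_unitary_conjugate[OF assms, of A V B] assms
    by (auto simp: A_numerical_range_def intro!: exI[of _ "U ** V ** W"] unitary_mult)
next
  fix z assume "z \<in> A_numerical_range (U ** A ** conj_transpose U) (conj_transpose W ** B ** W)"
  then obtain V where V: "unitary V" "z = trace (U ** A ** conj_transpose U **
      (V ** (conj_transpose W ** B ** W) ** conj_transpose V))"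
    by (auto simp: A_numerical_range_def)
  define V' where "V' = conj_transpose U ** V ** conj_transpose W"
  have "V = U ** V' ** W"
  proof -
    have "U ** V' ** W = (U ** conj_transpose U) ** V ** (conj_transpose W ** W)"
      by (simp add: V'_def matrix_mul_assoc)
    then show ?thesis using assms by (simp add: unitary_def)
  qed
  then show "z \<in> A_numerical_range A B"
    using V trace_unitary_conjugate[OF assms, of A V' B] assms
    by (auto simp: A_numerical_range_def V'_def
        intro!: exI[of _ "conj_transpose U ** V ** conj_transpose W"] unitary_mult unitary_conj_transpose)
qed

lemma trace_unitary_similar:
  assumes "unitary U"
  shows "trace (U ** A ** conj_transpose U) = trace (A :: complex ^ 'n ^ 'n)"
proof -
  have "trace (U ** (A ** conj_transpose U)) = trace (A ** conj_transpose U ** U)"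
    by (rule trace_mul_sym)
  then show ?thesis using assms by (simp add: matrix_mul_assoc[symmetric] unitary_def)
qed

lemma diagonal_in_numerical_range:
  assumes "unitary W"
  shows "(W ** B ** conj_transpose W) $ i $ i \<in> numerical_range B"
proof -
  define x where "x = (\<chi> j. cnj (W $ i $ j))"
  have "cinner_vec x x = (W ** conj_transpose W) $ i $ i"
    by (simp add: cinner_vec_def x_def matrix_matrix_mult_def conj_transpose_def)
  then have "cinner_vec x x = 1" using assms by (simp add: unitary_def mat_def)
  moreover have "(W ** B ** conj_transpose W) $ i $ i = cinner_vec x (B *v x)"
    by (simp add: cinner_vec_def x_def matrix_mul_assoc[symmetric])
       (simp add: matrix_matrix_mult_def matrix_vector_mult_def conj_transpose_def)
  ultimately show ?thesis by (auto simp: numerical_range_def)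
qed

section \<open>Convexity and compactness for matrices of size two\<close>

text \<open>
  The matrix with rows \<open>(a, b)\<close> and \<open>(c, d)\<close>.
\<close>
definition mat2 :: "complex \<Rightarrow> complex \<Rightarrow> complex \<Rightarrow> complex \<Rightarrow> complex ^ 2 ^ 2" where
  "mat2 a b c d = vector [vector [a, b], vector [c, d]]"

lemma mat2_nth [simp]:
  "mat2 a b c d $ 1 $ 1 = a" "mat2 a b c d $ 1 $ 2 = b"
  "mat2 a b c d $ 2 $ 1 = c" "mat2 a b c d $ 2 $ 2 = d"
  by (simp_all add: mat2_def)

text \<open>
  The matrix with first column \<open>v\<close> and second column orthogonal to it. It is real linear in \<open>v\<close>, and
  as \<open>v\<close> runs through the unit sphere it runs through \<open>SU(2)\<close>; \<open>\<complex> \<times> \<complex>\<close> serves as \<open>\<complex>\<^sup>2\<close>.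
\<close>
definition su2 :: "complex \<times> complex \<Rightarrow> complex ^ 2 ^ 2" where
  "su2 v = mat2 (fst v) (- cnj (snd v)) (snd v) (cnj (fst v))"

lemmas mat_expand = matrix_matrix_mult_def matrix_vector_mult_def conj_transpose_def
  trace_def mat_def vec_eq_iff forall_2 sum_2 forall_3 sum_3

lemma norm_prod_eq_1_iff:
  fixes v :: "complex \<times> complex"
  shows "norm v = 1 \<longleftrightarrow> fst v * cnj (fst v) + snd v * cnj (snd v) = 1"
proof -
  have "fst v * cnj (fst v) + snd v * cnj (snd v) = of_real ((norm v)\<^sup>2)"
    by (simp add: norm_prod_def flip: complex_norm_square)
  then show ?thesis by (metis norm_ge_zero of_real_1 of_real_eq_iff one_power2 power2_eq_imp_eq zero_le_one)
qed

lemma unitary_su2: "norm v = 1 \<Longrightarrow> unitary (su2 v)"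
  by (simp add: unitary_def su2_def mat_expand norm_prod_eq_1_iff algebra_simps)

lemma unitary_eq_su2:
  fixes V :: "complex ^ 2 ^ 2"
  assumes "unitary V"
  obtains \<mu> v where "cmod \<mu> = 1" "norm v = 1" "V = mat \<mu> ** su2 v"
proof -
  \<comment> \<open>A square root of the determinant, so that \<open>V\<close> divided by it has determinant \<open>1\<close>.\<close>
  define \<mu> where "\<mu> = csqrt (V $ 1 $ 1 * V $ 2 $ 2 - V $ 1 $ 2 * V $ 2 $ 1)"
  define x y where "x = V $ 1 $ 1" and "y = V $ 2 $ 1"
  define z w where "z = V $ 1 $ 2" and "w = V $ 2 $ 2"
  have 1: "x * cnj x + y * cnj y = 1" and 2: "z * cnj z + w * cnj w = 1"
    and 3: "cnj x * z + cnj y * w = 0" and 4: "x * cnj x + z * cnj z = 1"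
    and 5: "cnj z * x + cnj w * y = 0"
    using assms by (auto simp: unitary_def mat_expand x_def y_def z_def w_def algebra_simps)
  have \<mu>2: "\<mu> * \<mu> = x * w - z * y"
    by (simp add: \<mu>_def x_def y_def z_def w_def flip: power2_eq_square)
  have z: "z = - (\<mu> * \<mu>) * cnj y"
  proof -
    have "z = (x * cnj x + y * cnj y) * z" by (simp add: 1)
    also have "\<dots> = x * (cnj x * z + cnj y * w) - (x * w - z * y) * cnj y" by algebra
    finally show ?thesis unfolding 3 \<mu>2 by (simp add: algebra_simps)
  qed
  have w: "w = \<mu> * \<mu> * cnj x"
  proof -
    have "w = (x * cnj x + y * cnj y) * w" by (simp add: 1)
    also have "\<dots> = y * (cnj x * z + cnj y * w) + (x * w - z * y) * cnj x" by algebra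
    finally show ?thesis unfolding 3 \<mu>2 by simp
  qed
  have \<mu>4: "\<mu> * cnj \<mu> * (\<mu> * cnj \<mu>) = 1"
  proof -
    have "1 = \<mu> * cnj \<mu> * (\<mu> * cnj \<mu>) * (x * cnj x + y * cnj y)"
      using 2 unfolding z w by (simp add: algebra_simps)
    then show ?thesis by (simp add: 1)
  qed
  have "cmod \<mu> ^ 4 = 1 ^ 4"
    using arg_cong[OF \<mu>4, of cmod] by (simp add: norm_mult power4_eq_xxxx mult.assoc)
  then have \<mu>: "cmod \<mu> = 1" by (rule power_eq_imp_eq_base) auto
  then have \<mu>c: "\<mu> * cnj \<mu> = 1" by (simp add: complex_norm_square[symmetric])
  define v where "v = (cnj \<mu> * x, cnj \<mu> * y)"
  have "norm v = 1"
  proof -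
    have "cnj \<mu> * x * cnj (cnj \<mu> * x) + cnj \<mu> * y * cnj (cnj \<mu> * y)
        = (\<mu> * cnj \<mu>) * (x * cnj x + y * cnj y)" by (simp add: algebra_simps)
    then show ?thesis unfolding norm_prod_eq_1_iff v_def by (simp add: 1 \<mu>c)
  qed
  moreover have "V = mat \<mu> ** su2 v"
    using z w \<mu>c by (simp add: mat_expand su2_def v_def mult.assoc[symmetric]) 
      (simp add: x_def y_def z_def w_def)
  ultimately show ?thesis using \<mu> that by blast
qed

lemma A_numerical_range_su2:
  fixes A B :: "complex ^ 2 ^ 2"
  shows "A_numerical_range A B
    = (\<lambda>v. trace (A ** (su2 v ** B ** conj_transpose (su2 v)))) ` sphere 0 1"
proof (intro equalityI subsetI)
  fix z assume "z \<in> A_numerical_range A B"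
  then obtain V where V: "unitary V" "z = trace (A ** (V ** B ** conj_transpose V))"
    by (auto simp: A_numerical_range_def)
  obtain \<mu> v where \<mu>: "cmod \<mu> = 1" "norm v = 1" "V = mat \<mu> ** su2 v"
    using unitary_eq_su2[OF V(1)] .
  have c: "mat \<mu> ** X = X ** mat \<mu>" for X :: "complex ^ 2 ^ 2"
    by (simp add: mat_expand mult.commute)
  have "\<mu> * cnj \<mu> = 1" using \<mu>(1) by (simp add: complex_norm_square[symmetric])
  then have "mat \<mu> ** conj_transpose (mat \<mu>) = (mat 1 :: complex ^ 2 ^ 2)"
    by (simp add: mat_expand)
  moreover have "V ** B ** conj_transpose V
      = mat \<mu> ** (su2 v ** B ** conj_transpose (su2 v)) ** conj_transpose (mat \<mu>)"
    by (simp add: \<mu>(3) conj_transpose_mult matrix_mul_assoc)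
  ultimately have "V ** B ** conj_transpose V = su2 v ** B ** conj_transpose (su2 v)"
    unfolding c[of "su2 v ** B ** conj_transpose (su2 v)"] by (simp flip: matrix_mul_assoc)
  then show "z \<in> (\<lambda>v. trace (A ** (su2 v ** B ** conj_transpose (su2 v)))) ` sphere 0 1"
    using V \<mu> by auto
next
  fix z assume "z \<in> (\<lambda>v. trace (A ** (su2 v ** B ** conj_transpose (su2 v)))) ` sphere 0 1"
  then obtain v where "norm v = 1" "z = trace (A ** (su2 v ** B ** conj_transpose (su2 v)))"
    by auto
  then show "z \<in> A_numerical_range A B"
    using unitary_su2[of v] by (auto simp: A_numerical_range_def)
qed

lemma bilinear_su2:
  "bilinear (\<lambda>v w. trace (A ** (su2 v ** B ** conj_transpose (su2 w))))"
  by (auto simp: bilinear_def linear_iff su2_def mat_expand scaleR_conv_of_real algebra_simps)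

lemma compact_A_numerical_range: "compact (A_numerical_range A (B :: complex ^ 2 ^ 2))"
  unfolding A_numerical_range_su2
  using bilinear_su2[of A B] unfolding bilinear_conv_bounded_bilinear
  by (intro compact_continuous_image continuous_on_id compact_sphere
      bounded_bilinear.continuous_on
        [where prod = "\<lambda>v w. trace (A ** (su2 v ** B ** conj_transpose (su2 w)))"])


lemma convex_A_numerical_range: "convex (A_numerical_range A (B :: complex ^ 2 ^ 2))"
  unfolding A_numerical_range_su2
  using convex_quadratic_image_sphere[OF bilinear_su2[of A B]] by simp

text \<open>
  A point of the numerical range is the upper left entry of a unitarily similar matrix: its unit
  vector is completed to an orthonormal basis.
\<close>
lemma numerical_range_obtain_corner:
  fixes B :: "complex ^ 2 ^ 2"
  assumes "b \<in> numerical_range B"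
  obtains W where "unitary W" "(W ** B ** conj_transpose W) $ 1 $ 1 = b"
proof -
  obtain x where x: "cinner_vec x x = 1" "b = cinner_vec x (B *v x)"
    using assms by (auto simp: numerical_range_def)
  define v where "v = (cnj (x $ 1), - (x $ 2))"
  have "norm v = 1"
    using x(1) unfolding norm_prod_eq_1_iff by (simp add: v_def cinner_vec_def sum_2 mult.commute)
  then have "unitary (su2 v)" by (rule unitary_su2)
  moreover have "(su2 v ** B ** conj_transpose (su2 v)) $ 1 $ 1 = b"
    unfolding x(2) by (simp add: v_def su2_def cinner_vec_def mat_expand algebra_simps)
  ultimately show ?thesis by (rule that)
qed

lemma unitary_diag: "cmod a = 1 \<Longrightarrow> cmod d = 1 \<Longrightarrow> unitary (mat2 a 0 0 d)"
  by (simp add: unitary_def mat_expand complex_norm_square[symmetric] mult.commute[of "cnj _"])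

text \<open>
  The identity behind both directions. The hypotheses imply \<open>\<bar>l\<bar> = \<bar>t\<bar>\<close>, and for \<open>t > 0\<close>
  \<open>\<omega>\<close> is the phase of \<open>l\<close> relative to \<open>k\<close>; for \<open>t = 0\<close> it is arbitrary. Up to phases, the terms \<open>A\<^sub>1\<^sub>1 B\<^sub>1\<^sub>1\<close> and
  \<open>A\<^sub>2\<^sub>2 B\<^sub>2\<^sub>2\<close> enter with the weights \<open>1\<close> and \<open>t\<^sup>2\<close>, and the off-diagonal products with the weight
  \<open>t\<close>; the coefficients on the right match this because \<open>B\<^sub>2\<^sub>2 = - B\<^sub>1\<^sub>1\<close>.
\<close>
lemma trace_diag_compression:
  fixes A B :: "complex ^ 2 ^ 2"
  assumes "trace B = 0" "cmod k = 1" "cmod \<omega> = 1" "l * cnj k = of_real t * \<omega>"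
  shows "trace (A ** (mat2 k 0 0 l ** B ** conj_transpose (mat2 k 0 0 l))) =
    ((1 - t\<^sup>2) / 2) *\<^sub>R (trace A * B $ 1 $ 1)
    + ((1 + t)\<^sup>2 / 4) *\<^sub>R trace (A ** (mat2 1 0 0 \<omega> ** B ** conj_transpose (mat2 1 0 0 \<omega>)))
    + ((1 - t)\<^sup>2 / 4) *\<^sub>R trace (A ** (mat2 1 0 0 (- \<omega>) ** B ** conj_transpose (mat2 1 0 0 (- \<omega>))))"
proof -
  have k: "k * cnj k = 1" and w: "\<omega> * cnj \<omega> = 1"
    using assms by (simp_all add: complex_norm_square[symmetric])
  have lc: "k * cnj l = of_real t * cnj \<omega>"
    using arg_cong[OF assms(4), of cnj] by (simp add: mult.commute)
  have "l * cnj l = (k * cnj k) * (l * cnj l)" by (simp add: k)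
  also have "\<dots> = (l * cnj k) * (k * cnj l)" by (simp add: algebra_simps)
  also have "\<dots> = of_real (t\<^sup>2) * (\<omega> * cnj \<omega>)" by (simp add: assms(4) lc power2_eq_square)
  finally have l: "l * cnj l = of_real (t\<^sup>2)" by (simp add: w)
  have b: "B $ 2 $ 2 = - B $ 1 $ 1" using assms(1) by (simp add: mat_expand eq_neg_iff_add_eq_0 add.commute)
  define p q r s where "p = A $ 1 $ 1" and "q = A $ 1 $ 2" and "r = A $ 2 $ 1" and "s = A $ 2 $ 2"
  have D: "trace (A ** (mat2 a 0 0 d ** B ** conj_transpose (mat2 a 0 0 d)))
      = p * B $ 1 $ 1 * (a * cnj a) - s * B $ 1 $ 1 * (d * cnj d)
        + q * B $ 2 $ 1 * (d * cnj a) + r * B $ 1 $ 2 * (a * cnj d)" for a d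
    by (simp add: mat_expand b p_def q_def r_def s_def algebra_simps)
  have "trace A = p + s" by (simp add: mat_expand p_def s_def)
  then show ?thesis
    unfolding D assms(4) lc k l
    by (simp add: w scaleR_conv_of_real power2_eq_square field_simps)
qed

section \<open>Upper left blocks of unitary matrices of size three\<close>

text \<open>
  The direct sum of \<open>X\<close> with the \<open>1 \<times> 1\<close> identity matrix.
\<close>
definition dsum_one :: "complex ^ 2 ^ 2 \<Rightarrow> complex ^ 3 ^ 3" where
  "dsum_one X =
     vector [vector [X $ 1 $ 1, X $ 1 $ 2, 0],
             vector [X $ 2 $ 1, X $ 2 $ 2, 0],
             vector [0,         0,         1]]"

text \<open>
  The upper left \<open>2 \<times> 2\<close> block of \<open>V\<close>.
\<close>
definition corner :: "complex ^ 3 ^ 3 \<Rightarrow> complex ^ 2 ^ 2" where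
  "corner V = mat2 (V $ 1 $ 1) (V $ 1 $ 2) (V $ 2 $ 1) (V $ 2 $ 2)"

lemma trace_dsum_zero:
  "trace (dsum_zero A ** (V ** dsum_zero B ** conj_transpose V))
    = trace (A ** (corner V ** B ** conj_transpose (corner V)))"
  by (simp add: mat_expand dsum_zero_def corner_def algebra_simps)

lemma conj_transpose_dsum_one: "conj_transpose (dsum_one X) = dsum_one (conj_transpose X)"
  by (simp add: mat_expand dsum_one_def)

lemma dsum_one_mult: "dsum_one X ** dsum_one Y = dsum_one (X ** Y)"
  by (simp add: mat_expand dsum_one_def)

lemma dsum_one_zero_mult:
  "dsum_one X ** dsum_zero Y = dsum_zero (X ** Y)"
  "dsum_zero X ** dsum_one Y = dsum_zero (X ** Y)"
  by (simp_all add: mat_expand dsum_one_def dsum_zero_def)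

lemma unitary_dsum_one: "unitary X \<Longrightarrow> unitary (dsum_one X)"
  by (simp add: unitary_def conj_transpose_dsum_one dsum_one_mult)
     (simp add: mat_expand dsum_one_def)

lemma A_numerical_range_dsum_zero_unitary_conjugate:
  assumes "unitary U" "unitary W"
  shows "A_numerical_range (dsum_zero (U ** A ** conj_transpose U))
      (dsum_zero (conj_transpose W ** B ** W))
    = A_numerical_range (dsum_zero A) (dsum_zero B)"
  using A_numerical_range_unitary_conjugate[OF assms[THEN unitary_dsum_one], of "dsum_zero A" "dsum_zero B"]
  by (simp add: conj_transpose_dsum_one dsum_one_zero_mult)

lemma corner_in_A_numerical_range:
  "unitary V \<Longrightarrow> trace (A ** (corner V ** B ** conj_transpose (corner V)))
    \<in> A_numerical_range (dsum_zero A) (dsum_zero B)"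
  by (auto simp: A_numerical_range_def trace_dsum_zero[symmetric])

lemma A_numerical_range_subset_dsum_zero:
  "A_numerical_range A B \<subseteq> A_numerical_range (dsum_zero A) (dsum_zero B)"
proof
  fix z assume "z \<in> A_numerical_range A B"
  then obtain V where V: "unitary V" "z = trace (A ** (V ** B ** conj_transpose V))"
    by (auto simp: A_numerical_range_def)
  have "corner (dsum_one V) = V" by (simp add: corner_def dsum_one_def mat_expand)
  then show "z \<in> A_numerical_range (dsum_zero A) (dsum_zero B)"
    using corner_in_A_numerical_range[OF unitary_dsum_one[OF V(1)], of A B] V(2) by simp
qed

lemma diag_contraction_in_A_numerical_range:
  assumes "0 \<le> t" "t \<le> 1"
  shows "trace (A ** (mat2 1 0 0 (of_real t) ** B ** conj_transpose (mat2 1 0 0 (of_real t))))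
    \<in> A_numerical_range (dsum_zero A) (dsum_zero B)"
proof -
  define s where "s = sqrt (1 - t\<^sup>2)"
  have "t\<^sup>2 \<le> 1" using assms by (simp add: power_le_one)
  then have "t * t + s * s = 1" by (simp add: s_def flip: power2_eq_square)
  then have ts: "complex_of_real t * of_real t + of_real s * of_real s = 1"
    by (metis of_real_1 of_real_add of_real_mult)
  \<comment> \<open>A rotation in the last two coordinates, with \<open>t\<close> as the cosine.\<close>
  define R :: "complex ^ 3 ^ 3" where "R = vector [vector [1, 0, 0],
    vector [0, of_real t, - of_real s], vector [0, of_real s, of_real t]]"
  have "unitary R" using ts by (simp add: unitary_def R_def mat_expand add.commute)
  moreover have "corner R = mat2 1 0 0 (of_real t)" by (simp add: corner_def R_def)
  ultimately show ?thesis using corner_in_A_numerical_range[of R A B] by simp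
qed

lemma unitary_annihilate:
  fixes p q :: complex
  obtains W :: "complex ^ 2 ^ 2" where "unitary W" "p * W $ 1 $ 1 + q * W $ 2 $ 1 = 0"
proof (cases "p = 0 \<and> q = 0")
  case True
  have "unitary (mat 1 :: complex ^ 2 ^ 2)" by (simp add: unitary_def mat_expand)
  then show ?thesis using that True by auto
next
  case False
  define v where "v = (q, - p) /\<^sub>R norm (q, - p)"
  have "(q, - p) \<noteq> 0" using False by (auto simp: zero_prod_def)
  then have "norm v = 1" unfolding v_def by (subst norm_scaleR) simp
  moreover have "p * su2 v $ 1 $ 1 + q * su2 v $ 2 $ 1 = 0"
    by (simp add: su2_def v_def algebra_simps)
  ultimately show ?thesis using that unitary_su2 by blast
qed

text \<open>
  Orthogonality of rows \<open>1\<close> and \<open>3\<close> reads \<open>V\<^sub>1\<^sub>2 cnj V\<^sub>3\<^sub>2 = 0\<close>. If \<open>V\<^sub>3\<^sub>2 = 0\<close>, then \<open>V\<close> is the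
  direct sum of its corner and a phase; otherwise \<open>V\<^sub>1\<^sub>2 = 0\<close>, and the corner is diagonal.
\<close>
lemma corner_unitary_or_diag:
  assumes V: "unitary V" and 0: "V $ 1 $ 3 = 0" "V $ 3 $ 1 = 0"
  shows "unitary (corner V) \<or>
    (\<exists>k l. corner V = mat2 k 0 0 l \<and> cmod k = 1 \<and> cmod l \<le> 1)"
proof (cases "V $ 3 $ 2 = 0")
  case True
  have "V $ 3 $ 3 * cnj (V $ 3 $ 3) = 1"
    using V True 0 by (simp add: unitary_def mat_expand)
  moreover have "V $ 2 $ 3 * cnj (V $ 3 $ 3) = 0"
    using V True 0 by (simp add: unitary_def mat_expand)
  ultimately have "V $ 2 $ 3 = 0" by (metis mult_eq_0_iff zero_neq_one)
  then have "unitary (corner V)"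
    using V True 0 by (simp add: unitary_def mat_expand corner_def)
  then show ?thesis by simp
next
  case False
  have 1: "V $ 1 $ 2 = 0"
    using V False 0 by (simp add: unitary_def mat_expand)
  have k: "V $ 1 $ 1 * cnj (V $ 1 $ 1) = 1"
    using V 0 1 by (simp add: unitary_def mat_expand)
  have "cnj (V $ 1 $ 1) * V $ 1 $ 1 + cnj (V $ 2 $ 1) * V $ 2 $ 1 = 1"
    using V 0 by (simp add: unitary_def mat_expand)
  then have 2: "V $ 2 $ 1 = 0" using k by (simp add: mult.commute)
  have "V $ 2 $ 2 * cnj (V $ 2 $ 2) + V $ 2 $ 3 * cnj (V $ 2 $ 3) = 1"
    using V 2 by (simp add: unitary_def mat_expand)
  then have "complex_of_real ((cmod (V $ 2 $ 2))\<^sup>2 + (cmod (V $ 2 $ 3))\<^sup>2) = of_real 1"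
    by (simp only: complex_norm_square of_real_add of_real_1)
  then have "(cmod (V $ 2 $ 2))\<^sup>2 + (cmod (V $ 2 $ 3))\<^sup>2 = 1" by (simp only: of_real_eq_iff)
  then have "(cmod (V $ 2 $ 2))\<^sup>2 \<le> 1" by (smt (verit) zero_le_power2)
  then have "cmod (V $ 2 $ 2) \<le> 1" by (simp add: power_le_one_iff)
  moreover have "cmod (V $ 1 $ 1) = 1"
  proof -
    have "cmod (V $ 1 $ 1) ^ 2 = 1 ^ 2"
      using arg_cong[OF k, of cmod] by (simp add: norm_mult power2_eq_square)
    then show ?thesis by (rule power_eq_imp_eq_base) auto
  qed
  moreover have "corner V = mat2 (V $ 1 $ 1) 0 0 (V $ 2 $ 2)" by (simp add: corner_def 1 2)
  ultimately show ?thesis by blast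
qed

text \<open>
  Two entries of the \<open>3 \<times> 3\<close> unitary matrix can be made \<open>0\<close> by \<open>2 \<times> 2\<close> unitary changes of frame
  from the left and the right, which amount to unitary similarities of \<open>A\<close> and of \<open>B\<close>.
\<close>
lemma dsum_zero_range_unitary_frames:
  assumes "z \<in> A_numerical_range (dsum_zero A) (dsum_zero B)"
  obtains U W V where "unitary U" "unitary W" "unitary V" "V $ 1 $ 3 = 0" "V $ 3 $ 1 = 0"
    "z = trace (U ** A ** conj_transpose U **
      (corner V ** (conj_transpose W ** B ** W) ** conj_transpose (corner V)))"
proof -
  obtain X where X: "unitary X" "z = trace (dsum_zero A ** (X ** dsum_zero B ** conj_transpose X))"
    using assms by (auto simp: A_numerical_range_def)
  obtain W :: "complex ^ 2 ^ 2" where W: "unitary W"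
    "X $ 3 $ 1 * W $ 1 $ 1 + X $ 3 $ 2 * W $ 2 $ 1 = 0"
    by (rule unitary_annihilate)
  obtain T :: "complex ^ 2 ^ 2" where T: "unitary T"
    "cnj (X $ 1 $ 3) * T $ 1 $ 1 + cnj (X $ 2 $ 3) * T $ 2 $ 1 = 0"
    by (rule unitary_annihilate)
  define U where "U = conj_transpose T"
  have U: "unitary U" "U $ 1 $ 1 * X $ 1 $ 3 + U $ 1 $ 2 * X $ 2 $ 3 = 0"
    using T(1) arg_cong[OF T(2), of cnj]
    by (simp_all add: U_def unitary_conj_transpose) (simp add: conj_transpose_def mult.commute)
  define V where "V = dsum_one U ** X ** dsum_one W"
  have "unitary V" unfolding V_def using U W X by (intro unitary_mult unitary_dsum_one)
  moreover have "V $ 1 $ 3 = 0" "V $ 3 $ 1 = 0"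
    using U(2) W(2) by (simp_all add: V_def dsum_one_def mat_expand)
  moreover have "z = trace (U ** A ** conj_transpose U **
      (corner V ** (conj_transpose W ** B ** W) ** conj_transpose (corner V)))"
    using trace_unitary_conjugate[OF unitary_dsum_one[OF U(1)] unitary_dsum_one[OF W(1)],
        of "dsum_zero A" X "dsum_zero B"]
    by (simp add: X(2) V_def conj_transpose_dsum_one dsum_one_zero_mult flip: trace_dsum_zero)
  ultimately show ?thesis using that U(1) W(1) by blast
qed

section \<open>The two implications\<close>

lemma convex_combination3:
  assumes "convex S" "x \<in> S" "y \<in> S" "z \<in> S" "0 \<le> a" "0 \<le> b" "0 \<le> c" "a + b + c = 1"
  shows "a *\<^sub>R x + b *\<^sub>R y + c *\<^sub>R z \<in> S"
proof -
  have "a *\<^sub>R x + b *\<^sub>R y + c *\<^sub>R z \<in> convex hull {x, y, z}"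
    unfolding convex_hull_3 using assms by blast
  then show ?thesis using assms hull_minimal[of "{x, y, z}" S convex] by blast
qed

lemma dsum_zero_range_subset:
  assumes "trace B = 0"
    and sub: "(\<lambda>s. trace A * s) ` numerical_range B \<subseteq> A_numerical_range A B"
  shows "A_numerical_range (dsum_zero A) (dsum_zero B) \<subseteq> A_numerical_range A B"
proof
  fix z assume "z \<in> A_numerical_range (dsum_zero A) (dsum_zero B)"
  then obtain U W V where U: "unitary U" and W: "unitary W"
    and V: "unitary V" "V $ 1 $ 3 = 0" "V $ 3 $ 1 = 0"
    and z: "z = trace (U ** A ** conj_transpose U **
      (corner V ** (conj_transpose W ** B ** W) ** conj_transpose (corner V)))"
    by (rule dsum_zero_range_unitary_frames)
  define A' B' where "A' = U ** A ** conj_transpose U" and "B' = conj_transpose W ** B ** W"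
  have E: "A_numerical_range A B = A_numerical_range A' B'"
    unfolding A'_def B'_def by (simp add: A_numerical_range_unitary_conjugate U W)
  have mem: "trace (A' ** (X ** B' ** conj_transpose X)) \<in> A_numerical_range A B"
    if "unitary X" for X
    unfolding E using that by (auto simp: A_numerical_range_def)
  from corner_unitary_or_diag[OF V] show "z \<in> A_numerical_range A B"
  proof
    assume "unitary (corner V)"
    then show ?thesis using mem z by (simp add: A'_def B'_def)
  next
    assume "\<exists>k l. corner V = mat2 k 0 0 l \<and> cmod k = 1 \<and> cmod l \<le> 1"
    then obtain k l where K: "corner V = mat2 k 0 0 l" "cmod k = 1" "cmod l \<le> 1" by blast
    define t where "t = cmod l"
    \<comment> \<open>If \<open>l = 0\<close>, any phase will do.\<close>
    define \<omega> where "\<omega> = (if l = 0 then 1 else l * cnj k / of_real t)"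
    have \<omega>: "cmod \<omega> = 1" "l * cnj k = of_real t * \<omega>"
      using K by (auto simp: \<omega>_def t_def norm_mult norm_divide)
    have t: "0 \<le> t" "t \<le> 1" using K by (auto simp: t_def)
    have trA: "trace A' = trace A" unfolding A'_def by (rule trace_unitary_similar[OF U])
    have W': "unitary (conj_transpose W)" using W by (rule unitary_conj_transpose)
    have trB: "trace B' = 0"
      using trace_unitary_similar[OF W', of B] assms(1) by (simp add: B'_def)
    have "B' $ 1 $ 1 \<in> numerical_range B"
      using diagonal_in_numerical_range[OF W', of B 1] by (simp add: B'_def)
    then have "trace A' * B' $ 1 $ 1 \<in> A_numerical_range A B" using sub trA by auto
    moreover have "z = trace (A' ** (mat2 k 0 0 l ** B' ** conj_transpose (mat2 k 0 0 l)))"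
      using z K by (simp add: A'_def B'_def)
    moreover have "(1 - t\<^sup>2) / 2 + (1 + t)\<^sup>2 / 4 + (1 - t)\<^sup>2 / 4 = 1"
      by (simp add: power2_eq_square field_simps)
    moreover have "t\<^sup>2 \<le> 1" using t by (simp add: power_le_one)
    ultimately show ?thesis
      unfolding trace_diag_compression[OF trB K(2) \<omega>]
      using \<omega>(1) by (simp only:) (intro convex_combination3 convex_A_numerical_range mem unitary_diag; simp)
  qed
qed

lemma trace_mult_numerical_range_subset:
  fixes A B :: "complex ^ 2 ^ 2"
  assumes "trace B = 0"
    and eq: "A_numerical_range A B = A_numerical_range (dsum_zero A) (dsum_zero B)"
  shows "(\<lambda>s. trace A * s) ` numerical_range B \<subseteq> A_numerical_range A B"
proof (rule ccontr)
  define E where "E = A_numerical_range A B"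
  assume "\<not> ?thesis"
  then obtain b where b: "b \<in> numerical_range B" "trace A * b \<notin> E" by (auto simp: E_def)
  have cE: "compact E" unfolding E_def by (rule compact_A_numerical_range)
  obtain d c where d: "d \<bullet> (trace A * b) < c" "\<And>e. e \<in> E \<Longrightarrow> c < d \<bullet> e"
    using separating_hyperplane_closed_point[OF convex_A_numerical_range compact_imp_closed, of A B] cE b(2)
    unfolding E_def by blast
  have "unitary (mat 1 :: complex ^ 2 ^ 2)" by (simp add: unitary_def mat_expand)
  then have "E \<noteq> {}" by (auto simp: E_def A_numerical_range_def)
  then obtain m where m: "m \<in> E" "\<And>e. e \<in> E \<Longrightarrow> d \<bullet> m \<le> d \<bullet> e"
    using continuous_attains_inf[OF cE, of "\<lambda>e. d \<bullet> e"]
      continuous_on_inner[OF continuous_on_const continuous_on_id]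
    by blast
  obtain V where V: "unitary V" "m = trace (A ** (V ** B ** conj_transpose V))"
    using m(1) by (auto simp: E_def A_numerical_range_def)
  obtain T where T: "unitary T" "(T ** B ** conj_transpose T) $ 1 $ 1 = b"
    using numerical_range_obtain_corner[OF b(1)] .
  \<comment> \<open>The frame of \<open>B\<close> puts \<open>b\<close> in the upper left corner; the frame of \<open>A\<close> is then chosen so that the
    extremal value \<open>m\<close> is attained at the identity matrix.\<close>
  define U W where "U = T ** conj_transpose V" and "W = conj_transpose T"
  have U: "unitary U" and W: "unitary W"
    using T V by (auto simp: U_def W_def intro: unitary_mult unitary_conj_transpose)
  define A' B' where "A' = U ** A ** conj_transpose U" and "B' = conj_transpose W ** B ** W"
  have EA: "E = A_numerical_range A' B'"
    unfolding A'_def B'_def E_def by (simp add: A_numerical_range_unitary_conjugate U W)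
  have EF: "E = A_numerical_range (dsum_zero A') (dsum_zero B')"
    unfolding A'_def B'_def E_def eq
    by (simp add: A_numerical_range_dsum_zero_unitary_conjugate U W)
  have trA: "trace A' = trace A" unfolding A'_def by (rule trace_unitary_similar[OF U])
  have trB: "trace B' = 0"
    using trace_unitary_similar[OF T(1), of B] assms(1) by (simp add: B'_def W_def)
  have b': "B' $ 1 $ 1 = b" using T(2) by (simp add: B'_def W_def)
  define D where "D x = trace (A' ** (mat2 1 0 0 x ** B' ** conj_transpose (mat2 1 0 0 x)))" for x
  have "D 1 = m"
  proof -
    have "mat2 1 0 0 1 = U ** V ** W"
    proof -
      have "U ** V ** W = T ** (conj_transpose V ** V) ** conj_transpose T"
        by (simp add: U_def W_def matrix_mul_assoc)
      also have "\<dots> = mat 1" using T V by (simp add: unitary_def)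
      finally show ?thesis by (simp add: mat_expand)
    qed
    then show ?thesis using trace_unitary_conjugate[OF U W, of A V B] V(2)
      by (simp add: D_def A'_def B'_def)
  qed
  define p q r where "p = d \<bullet> (trace A * b)" and "q = d \<bullet> m" and "r = d \<bullet> D (- 1)"
  have pq: "p < q" using d m(1) by (force simp: p_def q_def)
  have ineq: "q \<le> (1 - t\<^sup>2) / 2 * p + (1 + t)\<^sup>2 / 4 * q + (1 - t)\<^sup>2 / 4 * r"
    if t: "0 \<le> t" "t \<le> 1" for t
  proof -
    have "D (of_real t) \<in> E"
      unfolding EF D_def by (rule diag_contraction_in_A_numerical_range[OF t])
    moreover have "D (of_real t) = ((1 - t\<^sup>2) / 2) *\<^sub>R (trace A * b)
        + ((1 + t)\<^sup>2 / 4) *\<^sub>R m + ((1 - t)\<^sup>2 / 4) *\<^sub>R D (- 1)"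
      using trace_diag_compression[OF trB, of 1 1 "of_real t" t A'] \<open>D 1 = m\<close>
      by (simp add: D_def trA b')
    ultimately show ?thesis
      using m(2)[of "D (of_real t)"] by (simp add: inner_add_right p_def q_def r_def)
  qed
  \<comment> \<open>With \<open>s = 1 - t\<close>, the inequality says \<open>s (q - p) \<le> s\<^sup>2 (q + r - 2 p) / 4\<close>, which fails for small
    \<open>s > 0\<close>.\<close>
  define M where "M = \<bar>(q + r - 2 * p) / 4\<bar>"
  define s where "s = min 1 ((q - p) / (2 * (M + 1)))"
  have M: "0 \<le> M" "(q + r - 2 * p) / 4 \<le> M" by (simp_all only: M_def abs_ge_zero abs_ge_self)
  have s: "0 < s" "s \<le> 1" "s * (M + 1) \<le> (q - p) / 2"
  proof -
    show "0 < s" "s \<le> 1" using pq M by (auto simp: s_def)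
    have "s * (M + 1) \<le> (q - p) / (2 * (M + 1)) * (M + 1)"
      using M by (intro mult_right_mono) (auto simp: s_def)
    also have "\<dots> = (q - p) / 2" using M(1) by (simp add: divide_simps)
    finally show "s * (M + 1) \<le> (q - p) / 2" .
  qed
  have "0 \<le> s * (s * ((q + r - 2 * p) / 4) - (q - p))"
    using ineq[of "1 - s"] s by (simp add: power2_eq_square field_simps)
  then have "q - p \<le> s * ((q + r - 2 * p) / 4)" using s(1) by (simp add: zero_le_mult_iff)
  also have "\<dots> \<le> s * (M + 1)" using s M by (intro mult_left_mono) auto
  finally show False using s(3) pq by simp
qed

theorem theorem9:
  fixes A B :: "complex ^ 2 ^ 2"
  assumes "trace B = 0"
  shows "A_numerical_range A B = A_numerical_range (dsum_zero A) (dsum_zero B) \<longleftrightarrow>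
         (\<lambda>s. trace A * s) ` numerical_range B \<subseteq> A_numerical_range A B"
proof
  assume "A_numerical_range A B = A_numerical_range (dsum_zero A) (dsum_zero B)"
  then show "(\<lambda>s. trace A * s) ` numerical_range B \<subseteq> A_numerical_range A B"
    by (rule trace_mult_numerical_range_subset[OF assms])
next
  assume "(\<lambda>s. trace A * s) ` numerical_range B \<subseteq> A_numerical_range A B"
  then show "A_numerical_range A B = A_numerical_range (dsum_zero A) (dsum_zero B)"
    by (intro subset_antisym A_numerical_range_subset_dsum_zero dsum_zero_range_subset[OF assms])
qed

end
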